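(* Let $G$ and $H$ be two nontrivial graphs such that $G$ is connected and the lexicographic product $G\circ H$ is not complete. Then $tpc(G\circ H)=3$.
   Context: All graphs are simple, finite and undirected; nontrivial means having at least two vertices. The lexicographic product $G\circ H$ has vertex set $V(G)\times V(H)$, with $(g,h)$ adjacent to $(g',h')$ iff $gg'\in E(G)$, or $g=g'$ and $hh'\in E(H)$. A graph is total-colored if all its vertices and edges are assigned colors. A path in a total-colored graph is a total proper path if (i) any two adjacent edges on the path differ in color, (ii) any two adjacent internal vertices of the path differ in color, and (iii) every internal vertex of the path differs in color from the edges of the path incident with it. A total-colored graph is total-proper connected if any two vertices are joined by a total proper path. For a connected graph $G$, $tpc(G)$ is the smallest number of colors in a total-coloring making $G$ total-proper connected. *)

theory Defs
  imports "Graph_Theory.Graph_Theory"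
begin

text \<open>
  A finite simple undirected graph is a \<^locale>\<open>pair_graph\<close>: a finite vertex set together with
  a symmetric irreflexive arc relation on it. An undirected edge corresponds to two opposite arcs,
  so edge colours are attached to the unordered pair \<open>{u, v}\<close>.
\<close>

definition uedges :: "'a pair_pre_digraph \<Rightarrow> 'a set set" where
  "uedges G = {{u, v} | u v. (u, v) \<in> parcs G}"

definition lexicographic_product :: "'a pair_pre_digraph \<Rightarrow> 'b pair_pre_digraph \<Rightarrow> ('a \<times> 'b) pair_pre_digraph" where
  "lexicographic_product G H = \<lparr> pverts = pverts G \<times> pverts H,
     parcs = {((g, h), (g', h')).
       (g, h) \<in> pverts G \<times> pverts H \<and> (g', h') \<in> pverts G \<times> pverts H \<and>
       ((g, g') \<in> parcs G \<or> g = g' \<and> (h, h') \<in> parcs H)} \<rparr>"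

definition complete_graph :: "'a pair_pre_digraph \<Rightarrow> bool" where
  "complete_graph G \<longleftrightarrow> complete_digraph (card (pverts G)) (with_proj G)"

text \<open>
  A total-colouring consists of an arbitrary vertex colouring \<open>cv\<close> and an arbitrary edge
  colouring \<open>ce\<close> with a common set of colours. A path is given by the list \<open>p\<close> of its
  pairwise distinct vertices; its internal vertices are the \<open>p ! i\<close> with \<open>0 < i\<close> and
  \<open>i + 1 < length p\<close>. Adjacency of internal vertices is meant along the path.
\<close>

definition total_proper_path ::
  "'a pair_pre_digraph \<Rightarrow> ('a \<Rightarrow> nat) \<Rightarrow> ('a set \<Rightarrow> nat) \<Rightarrow> 'a list \<Rightarrow> bool" where
  "total_proper_path G cv ce p \<longleftrightarrow> vpath p (with_proj G) \<and>
     (\<forall>i. i + 2 < length p \<longrightarrow> ce {p ! i, p ! (i + 1)} \<noteq> ce {p ! (i + 1), p ! (i + 2)}) \<and>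
     (\<forall>i. 0 < i \<and> i + 2 < length p \<longrightarrow> cv (p ! i) \<noteq> cv (p ! (i + 1))) \<and>
     (\<forall>i. 0 < i \<and> i + 1 < length p \<longrightarrow>
        cv (p ! i) \<noteq> ce {p ! (i - 1), p ! i} \<and> cv (p ! i) \<noteq> ce {p ! i, p ! (i + 1)})"

definition total_proper_connected ::
  "'a pair_pre_digraph \<Rightarrow> ('a \<Rightarrow> nat) \<Rightarrow> ('a set \<Rightarrow> nat) \<Rightarrow> bool" where
  "total_proper_connected G cv ce \<longleftrightarrow>
     (\<forall>u\<in>pverts G. \<forall>v\<in>pverts G. \<exists>p. total_proper_path G cv ce p \<and> hd p = u \<and> last p = v)"

definition num_colors :: "'a pair_pre_digraph \<Rightarrow> ('a \<Rightarrow> nat) \<Rightarrow> ('a set \<Rightarrow> nat) \<Rightarrow> nat" where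
  "num_colors G cv ce = card (cv ` pverts G \<union> ce ` uedges G)"

text \<open>Only meaningful for connected graphs, where by \<open>ex_total_proper_connected\<close> below the
  minimum is over a nonempty set.\<close>

definition tpc :: "'a pair_pre_digraph \<Rightarrow> nat" where
  "tpc G = (LEAST k. \<exists>cv ce. total_proper_connected G cv ce \<and> num_colors G cv ce = k)"

lemma pair_graph_lexicographic_product:
  assumes "pair_graph G" and "pair_graph H"
  shows "pair_graph (lexicographic_product G H)"
proof -
  interpret G: pair_graph G by fact
  interpret H: pair_graph H by fact
  have fin: "finite (pverts (lexicographic_product G H))"
    by (simp add: lexicographic_product_def G.pair_finite_verts H.pair_finite_verts)
  have "parcs (lexicographic_product G H) \<subseteq> pverts (lexicographic_product G H) \<times> pverts (lexicographic_product G H)"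
    by (auto simp: lexicographic_product_def)
  then have "finite (parcs (lexicographic_product G H))"
    using fin by (meson finite_SigmaI finite_subset)
  moreover have "symmetric (with_proj (lexicographic_product G H))"
    unfolding symmetric_def sym_def
    using G.arcs_symmetric H.arcs_symmetric by (simp add: lexicographic_product_def) blast
  moreover have "fst e \<noteq> snd e" if "e \<in> parcs (lexicographic_product G H)" for e
    using that G.pair_no_loops H.pair_no_loops
    by (fastforce simp: lexicographic_product_def)
  moreover have "fst e \<in> pverts (lexicographic_product G H)"
    "snd e \<in> pverts (lexicographic_product G H)"
    if "e \<in> parcs (lexicographic_product G H)" for e
    using that by (auto simp: lexicographic_product_def)
  ultimately show ?thesis
    using fin by unfold_locales blast+
qed

lemma ex_total_proper_connected:
  assumes "pair_graph G" and "Digraph_Component.connected (with_proj G)"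
  shows "\<exists>cv ce. total_proper_connected G cv ce"
proof -
  interpret pair_graph G by fact
  have conn: "strongly_connected (with_proj G)"
    using symmetric_connected_imp_strongly_connected[OF sym_arcs assms(2)] .
  obtain f :: "'a \<Rightarrow> nat" where f: "inj_on f (pverts G)"
    using finite_imp_inj_to_nat_seg[OF pair_finite_verts] by metis
  have "finite (Pow (pverts G))"
    using pair_finite_verts by simp
  then obtain g :: "'a set \<Rightarrow> nat" where g: "inj_on g (Pow (pverts G))"
    using finite_imp_inj_to_nat_seg by metis
  define cv where "cv = (\<lambda>v. 2 * f v)"
  define ce where "ce = (\<lambda>e. 2 * g e + 1)"
  have ne: "cv v \<noteq> ce e" for v e
    unfolding cv_def ce_def by presburger
  have tp: "total_proper_path G cv ce p" if p: "vpath p (with_proj G)" for p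
  proof -
    have d: "distinct p" and s: "set p \<subseteq> pverts G"
      using p by (auto simp: vpath_def vwalk_def)
    have "ce {p ! i, p ! (i + 1)} \<noteq> ce {p ! (i + 1), p ! (i + 2)}" if i: "i + 2 < length p" for i
    proof -
      have "p ! i \<in> pverts G" "p ! (i + 1) \<in> pverts G" "p ! (i + 2) \<in> pverts G"
        by (rule subsetD[OF s nth_mem], use i in simp)+
      moreover have "p ! i \<noteq> p ! (i + 1)" "p ! i \<noteq> p ! (i + 2)"
        using i by (simp_all add: nth_eq_iff_index_eq[OF d])
      ultimately have "g {p ! i, p ! (i + 1)} \<noteq> g {p ! (i + 1), p ! (i + 2)}"
        by (subst inj_on_eq_iff[OF g]) (auto simp: doubleton_eq_iff)
      then show ?thesis
        by (simp add: ce_def)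
    qed
    moreover have "cv (p ! i) \<noteq> cv (p ! (i + 1))" if i: "0 < i" "i + 2 < length p" for i
    proof -
      have "p ! i \<in> pverts G" "p ! (i + 1) \<in> pverts G"
        by (rule subsetD[OF s nth_mem], use i in simp)+
      moreover have "p ! i \<noteq> p ! (i + 1)"
        using i by (simp_all add: nth_eq_iff_index_eq[OF d])
      ultimately show ?thesis
        by (simp add: cv_def inj_on_eq_iff[OF f])
    qed
    ultimately show ?thesis
      using p ne unfolding total_proper_path_def by blast
  qed
  have "\<exists>p. vpath p (with_proj G) \<and> hd p = u \<and> last p = v"
    if "u \<in> pverts G" "v \<in> pverts G" for u v
  proof -
    have "u \<rightarrow>\<^sup>*\<^bsub>with_proj G\<^esub> v"
      using conn that by (simp add: strongly_connected_def)
    then show ?thesis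
      unfolding reachable_vpath_conv by blast
  qed
  then have "total_proper_connected G cv ce"
    using tp unfolding total_proper_connected_def by blast
  then show ?thesis by blast
qed

end

theory Submission
  imports Defs
begin

text \<open>
  Two non-adjacent vertices are joined by a path with an internal vertex, whose colour and the colours
  of its two edges are distinct; this is the lower bound.

  For the upper bound, let \<open>l\<close> be a non-cut vertex of \<open>G\<close>, let \<open>r\<close> be a neighbour of \<open>l\<close>, and let every
  other vertex have its distance from \<open>r\<close> in \<open>G - l\<close> as its depth. Fix two vertices \<open>h1\<close>, \<open>h2\<close> of \<open>H\<close>. Colours
  depending on the depth modulo 3 make every walk up the copy \<open>h1\<close> to \<open>(r, h1)\<close> and every walk down the
  copy \<open>h2\<close> from \<open>(r, h2)\<close> rotate through the three colours in the same direction, and the vertex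
  \<open>(l, h1)\<close> is coloured so as to link the former to the latter. Repeated vertices on such a walk can
  be removed, because the rotation is determined by the colour of the current vertex.
\<close>

section \<open>Layerings avoiding a non-cut vertex\<close>

definition rel_dist :: "('a \<times> 'a) set \<Rightarrow> 'a \<Rightarrow> 'a \<Rightarrow> nat" where
  "rel_dist R x v = (LEAST n. (x, v) \<in> R ^^ n)"

lemma rel_dist_self [simp]: "rel_dist R x x = 0"
  unfolding rel_dist_def by (rule Least_eq_0) simp

text \<open>The last but one vertex of a shortest path: a shorter way to it would also shorten the
  way to \<open>v\<close>.\<close>

lemma rel_dist_predecessor:
  assumes "(x, v) \<in> R\<^sup>*" and "v \<noteq> x"
  obtains p where "(x, p) \<in> R\<^sup>*" and "(p, v) \<in> R" and "rel_dist R x v = Suc (rel_dist R x p)"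
proof -
  have dist: "(x, y) \<in> R ^^ rel_dist R x y" if "(x, y) \<in> R\<^sup>*" for y
    using that unfolding rel_dist_def by (metis LeastI rtrancl_imp_relpow)
  have dist_le: "rel_dist R x y \<le> n" if "(x, y) \<in> R ^^ n" for y n
    using that unfolding rel_dist_def by (rule Least_le)
  obtain m where m: "rel_dist R x v = Suc m"
    using dist[OF assms(1)] assms(2) by (cases "rel_dist R x v") auto
  then obtain p where p: "(x, p) \<in> R ^^ m" "(p, v) \<in> R"
    using dist[OF assms(1)] by auto
  have xp: "(x, p) \<in> R\<^sup>*"
    using p(1) by (rule relpow_imp_rtrancl)
  have "(x, v) \<in> R ^^ Suc (rel_dist R x p)"
    using dist[OF xp] p(2) by auto
  then have "Suc m \<le> Suc (rel_dist R x p)"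
    using dist_le m by metis
  then show thesis
    using that[OF xp p(2)] dist_le[OF p(1)] m by linarith
qed

text \<open>The vertex \<open>l\<close> is taken farthest from some vertex, so that removing it keeps the graph connected.\<close>

lemma ex_layering:
  assumes fin: "finite V" and card: "2 \<le> card V" and R: "R \<subseteq> V \<times> V" and sym: "sym R"
    and conn: "\<And>u v. u \<in> V \<Longrightarrow> v \<in> V \<Longrightarrow> (u, v) \<in> R\<^sup>*"
  obtains r l and d :: "'a \<Rightarrow> nat" where "(r, l) \<in> R" and "r \<noteq> l" and "d r = 0" and "d l = 1"
    and "\<And>v. v \<in> V \<Longrightarrow> v \<noteq> r \<Longrightarrow> \<exists>p. p \<noteq> l \<and> (p, v) \<in> R \<and> d v = Suc (d p)"
proof -
  obtain x y where xy: "x \<in> V" "y \<in> V" "y \<noteq> x"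
    using card card_le_Suc0_iff_eq[OF fin] by fastforce
  define D where "D = rel_dist R x"
  have "Max (D ` V) \<in> D ` V"
    using fin xy(1) by (intro Max_in) auto
  then obtain l where l: "l \<in> V" "D l = Max (D ` V)"
    by auto
  then have max: "D v \<le> D l" if "v \<in> V" for v
    using fin that by simp
  have D_pred: "\<exists>p. (p, v) \<in> R \<and> D v = Suc (D p)" if "v \<in> V" "v \<noteq> x" for v
    unfolding D_def by (rule rel_dist_predecessor[OF conn[OF xy(1) that(1)] that(2)]) blast
  have "l \<noteq> x"
    using max[OF xy(2)] D_pred[OF xy(2,3)] unfolding D_def by auto
  define S where "S = R \<inter> (V - {l}) \<times> (V - {l})"
  \<comment> \<open>Predecessors have strictly smaller \<open>D\<close>, while \<open>D l\<close> is
    maximal, so tracing predecessors back to \<open>x\<close> never meets \<open>l\<close>.\<close>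
  have xS: "(x, v) \<in> S\<^sup>*" if "v \<in> V" "v \<noteq> l" for v
    using that
  proof (induction "D v" arbitrary: v rule: less_induct)
    case less
    show ?case
    proof (cases "v = x")
      case False
      then obtain p where p: "(p, v) \<in> R" "D v = Suc (D p)"
        using D_pred less.prems by blast
      then have "p \<in> V" "p \<noteq> l"
        using R max[OF less.prems(1)] by auto
      then have "(x, p) \<in> S\<^sup>*" "(p, v) \<in> S"
        using less p unfolding S_def by auto
      then show ?thesis by simp
    qed simp
  qed
  obtain r where r: "(r, l) \<in> R" "D l = Suc (D r)"
    using D_pred[OF l(1) \<open>l \<noteq> x\<close>] by blast
  then have "r \<noteq> l" by auto
  have "r \<in> V" using r(1) R by auto
  have "sym S"
    using sym unfolding S_def sym_def by auto
  then have "(r, x) \<in> S\<^sup>*"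
    using symD[OF sym_rtrancl xS[OF \<open>r \<in> V\<close> \<open>r \<noteq> l\<close>]] by blast
  then have rS: "(r, v) \<in> S\<^sup>*" if "v \<in> V" "v \<noteq> l" for v
    using rtrancl_trans[OF _ xS[OF that]] by blast
  \<comment> \<open>\<open>S\<close> does not reach \<open>l\<close>, so its depth is set by hand,
    as a child of \<open>r\<close>.\<close>
  define d where "d = (rel_dist S r)(l := 1)"
  show thesis
  proof
    show "(r, l) \<in> R" "r \<noteq> l" "d r = 0" "d l = 1"
      using r(1) \<open>r \<noteq> l\<close> by (simp_all add: d_def)
    fix v assume v: "v \<in> V" "v \<noteq> r"
    show "\<exists>p. p \<noteq> l \<and> (p, v) \<in> R \<and> d v = Suc (d p)"
    proof (cases "v = l")
      case True
      then show ?thesis using r(1) \<open>r \<noteq> l\<close> by (intro exI[of _ r]) (simp add: d_def)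
    next
      case False
      from rel_dist_predecessor[OF rS[OF v(1) False] v(2)]
      obtain p where "(p, v) \<in> S" "rel_dist S r v = Suc (rel_dist S r p)" .
      then show ?thesis using False by (intro exI[of _ p]) (simp add: S_def d_def)
    qed
  qed
qed

section \<open>Total proper paths with three colours\<close>

lemma three_le_num_colors:
  assumes P: "pair_graph P" and nc: "\<not> complete_graph P" and con: "total_proper_connected P cv ce"
  shows "3 \<le> num_colors P cv ce"
proof -
  interpret pair_graph P by fact
  have "parcs P \<subseteq> {(u, v). (u, v) \<in> pverts P \<times> pverts P \<and> u \<noteq> v}"
    using in_arcsD1 in_arcsD2 pair_no_loops by fastforce
  then obtain u v where uv: "u \<in> pverts P" "v \<in> pverts P" "u \<noteq> v" "(u, v) \<notin> parcs P"
    using nc pair_finite_verts unfolding complete_graph_def complete_digraph_pair_def by blast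
  then obtain p where p: "total_proper_path P cv ce p" "hd p = u" "last p = v"
    using con unfolding total_proper_connected_def by blast
  obtain x y q where pq: "p = u # x # y # q"
  \<comment> \<open>The rule serves only to split lists into those with no, one, or at least two
    elements.\<close>
  proof (cases p rule: remdups_adj.cases)
    case 1
    then show ?thesis using p(1) by (simp add: total_proper_path_def vpath_def vwalk_def)
  next
    case (2 a)
    then show ?thesis using p uv by simp
  next
    case (3 a b q)
    then show ?thesis
      using that p uv by (cases q) (auto simp: total_proper_path_def vpath_def vwalk_def)
  qed
  have w: "x \<in> pverts P" "(u, x) \<in> parcs P" "(x, y) \<in> parcs P"
    using p(1) by (auto simp: pq total_proper_path_def vpath_def vwalk_def)
  have "ce {u, x} \<noteq> ce {x, y}" "cv x \<noteq> ce {u, x}" "cv x \<noteq> ce {x, y}"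
    using p(1) unfolding pq total_proper_path_def
    by (force dest: spec[of _ 0] spec[of _ 1])+
  then have "card {ce {u, x}, cv x, ce {x, y}} = 3"
    by auto
  moreover have "{ce {u, x}, cv x, ce {x, y}} \<subseteq> cv ` pverts P \<union> ce ` uedges P"
    using w by (auto simp: uedges_def)
  moreover have "finite (cv ` pverts P \<union> ce ` uedges P)"
  proof -
    have "uedges P = (\<lambda>(u, v). {u, v}) ` parcs P"
      by (auto simp: uedges_def)
    then show ?thesis
      using pair_finite_verts pair_finite_arcs by simp
  qed
  ultimately show ?thesis
    unfolding num_colors_def by (metis card_mono)
qed

section \<open>Rotating walks and the paths they contain\<close>

text \<open>Walks are handled below as functions on \<open>{..n}\<close>, with \<open>n\<close> the
  number of arcs, so that cutting and reversing become index arithmetic; this leads back to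
  lists.\<close>

lemma total_proper_path_map:
  assumes verts: "\<And>i. i \<le> n \<Longrightarrow> g i \<in> pverts P" and inj: "inj_on g {..n}"
    and arcs: "\<And>i. i < n \<Longrightarrow> (g i, g (Suc i)) \<in> parcs P"
    and vv: "\<And>i. 0 < i \<Longrightarrow> Suc i < n \<Longrightarrow> cv (g i) \<noteq> cv (g (Suc i))"
    and ee: "\<And>i. Suc i < n \<Longrightarrow> ce {g i, g (Suc i)} \<noteq> ce {g (Suc i), g (Suc (Suc i))}"
    and ve: "\<And>i. 0 < i \<Longrightarrow> i < n \<Longrightarrow>
      cv (g i) \<noteq> ce {g (i - 1), g i} \<and> cv (g i) \<noteq> ce {g i, g (Suc i)}"
  shows "total_proper_path P cv ce (map g [0..<Suc n])"
proof -
  let ?p = "map g [0..<Suc n]"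
  have nth: "?p ! i = g i" if "i \<le> n" for i
    using that by (simp del: upt_Suc)
  have walk: "set (vwalk_arcs (map g [i..<j])) \<subseteq> parcs P" if "j \<le> Suc n" for i j
    using that
  proof (induction "j - i" arbitrary: i)
    case (Suc k)
    then have "[i..<j] = i # [Suc i..<j]"
      by (simp add: upt_conv_Cons)
    moreover have "set (vwalk_arcs (map g [Suc i..<j])) \<subseteq> parcs P"
      using Suc by simp
    ultimately show ?case
      using arcs[of i] Suc.prems by (cases "Suc i < j") (auto simp: upt_conv_Cons)
  qed simp
  have "vpath ?p (with_proj P)"
    using walk[of "Suc n" 0] verts inj
    by (auto simp: vpath_def vwalk_def distinct_map atLeast0LessThan lessThan_Suc_atMost simp del: upt_Suc)
  then show ?thesis
    unfolding total_proper_path_def using vv ee ve by (auto simp: nth simp del: upt_Suc)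
qed

text \<open>
  With three colours, the elements of a total proper path, read as edge, vertex, edge, vertex, \<dots>,
  repeat with period three. We only use the rotation \<open>0, 1, 2\<close>; the other one is its reversal.
\<close>

definition rot_in :: "('a \<Rightarrow> nat) \<Rightarrow> ('a set \<Rightarrow> nat) \<Rightarrow> 'a \<Rightarrow> 'a \<Rightarrow> bool" where
  "rot_in cv ce x y \<longleftrightarrow> cv y = (ce {x, y} + 1) mod 3"

definition rot_out :: "('a \<Rightarrow> nat) \<Rightarrow> ('a set \<Rightarrow> nat) \<Rightarrow> 'a \<Rightarrow> 'a \<Rightarrow> bool" where
  "rot_out cv ce x y \<longleftrightarrow> ce {x, y} = (cv x + 1) mod 3"

text \<open>Vertices may repeat, and the colours of the two ends are unconstrained, as in a total
  proper path.\<close>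

definition rot_walk :: "'a pair_pre_digraph \<Rightarrow> ('a \<Rightarrow> nat) \<Rightarrow> ('a set \<Rightarrow> nat) \<Rightarrow> (nat \<Rightarrow> 'a) \<Rightarrow> nat \<Rightarrow> bool" where
  "rot_walk P cv ce g n \<longleftrightarrow> (\<forall>i\<le>n. g i \<in> pverts P) \<and> (\<forall>i<n. (g i, g (Suc i)) \<in> parcs P) \<and>
     (\<forall>i. Suc i < n \<longrightarrow> rot_in cv ce (g i) (g (Suc i)) \<and> rot_out cv ce (g (Suc i)) (g (Suc (Suc i))))"

text \<open>The colour of an internal vertex determines those of its two edges on the walk, so a closed
  detour can be cut out.\<close>

lemma rot_walk_shortcut:
  assumes w: "rot_walk P cv ce g n" and ij: "i < j" "j \<le> n"
    and lo: "\<And>k. k \<le> i \<Longrightarrow> f k = g k" and hi: "\<And>k. i \<le> k \<Longrightarrow> f k = g (k + (j - i))"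
  shows "rot_walk P cv ce f (n - (j - i))"
proof -
  have verts: "g k \<in> pverts P" if "k \<le> n" for k
    using w that unfolding rot_walk_def by blast
  have arc: "(g k, g (Suc k)) \<in> parcs P" if "k < n" for k
    using w that unfolding rot_walk_def by blast
  have inn: "rot_in cv ce (g k) (g (Suc k))"
    and out: "rot_out cv ce (g (Suc k)) (g (Suc (Suc k)))" if "Suc k < n" for k
    using w that unfolding rot_walk_def by blast+
  have hi': "f (Suc k) = g (Suc (k + (j - i)))" if "i \<le> Suc k" for k
    using hi[OF that] by simp
  show ?thesis
    unfolding rot_walk_def
  proof (intro conjI allI impI)
    fix k assume k: "k \<le> n - (j - i)"
    show "f k \<in> pverts P"
    proof (cases "k \<le> i")
      case True
      with ij have "k \<le> n" by linarith
      then show ?thesis using lo[OF True] verts by simp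
    next
      case False
      with k have "k + (j - i) \<le> n" by linarith
      then show ?thesis using hi[of k] False verts by simp
    qed
  next
    fix k assume k: "k < n - (j - i)"
    show "(f k, f (Suc k)) \<in> parcs P"
    proof (cases "Suc k \<le> i")
      case True
      with ij have "k < n" by linarith
      then show ?thesis using lo[OF True] lo[of k] True arc by simp
    next
      case False
      with k have "k + (j - i) < n" by linarith
      then show ?thesis using hi[of k] hi'[of k] False arc by simp
    qed
  next
    fix k assume k: "Suc k < n - (j - i)"
    \<comment> \<open>At the junction the incoming edge is taken from before \<open>i\<close> and
      the outgoing one from after \<open>j\<close>; hence the two conditions are split at
      \<open>i\<close> separately.\<close>
    show "rot_in cv ce (f k) (f (Suc k))"
    proof (cases "Suc k \<le> i")
      case True
      with ij have "Suc k < n" by linarith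
      then show ?thesis using lo[OF True] lo[of k] True inn by simp
    next
      case False
      with k have "Suc (k + (j - i)) < n" by linarith
      then show ?thesis using hi[of k] hi'[of k] False inn by simp
    qed
    show "rot_out cv ce (f (Suc k)) (f (Suc (Suc k)))"
    proof (cases "Suc (Suc k) \<le> i")
      case True
      with ij have "Suc k < n" by linarith
      then show ?thesis using lo[OF True] lo[of "Suc k"] True out by simp
    next
      case False
      with k have "Suc (k + (j - i)) < n" by linarith
      then show ?thesis using hi'[of k] hi'[of "Suc k"] False out by simp
    qed
  qed
qed

lemma hd_last_map_upt:
  "hd (map g [0..<Suc n]) = g 0" "last (map g [0..<Suc n]) = g n"
  by (simp add: upt_conv_Cons del: upt_Suc) simp

text \<open>A rotating walk with the fewest arcs between the given ends repeats no vertex, by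
  \<open>rot_walk_shortcut\<close>. Three consecutive terms of the rotation are distinct, so it is
  total proper, and so is its reversal.\<close>

lemma rot_walk_imp_total_proper_paths:
  assumes P: "pair_graph P" and ce: "\<And>e. ce e < 3" and w: "rot_walk P cv ce g n"
  shows "\<exists>p. total_proper_path P cv ce p \<and> hd p = g 0 \<and> last p = g n"
    and "\<exists>p. total_proper_path P cv ce p \<and> hd p = g n \<and> last p = g 0"
proof -
  interpret pair_graph P by fact
  define Q where "Q m \<longleftrightarrow> (\<exists>f. rot_walk P cv ce f m \<and> f 0 = g 0 \<and> f m = g n)" for m
  define m where "m = (LEAST m. Q m)"
  have "Q n" using w unfolding Q_def by blast
  then have "Q m" unfolding m_def by (rule LeastI)
  then obtain f where f: "rot_walk P cv ce f m" "f 0 = g 0" "f m = g n"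
    unfolding Q_def by blast
  have min: "m \<le> k" if "Q k" for k
    using that unfolding m_def by (rule Least_le)
  have no_repeat: "f i \<noteq> f j" if ij: "i < j" "j \<le> m" for i j
  proof
    assume eq: "f i = f j"
    let ?f = "\<lambda>k. if k \<le> i then f k else f (k + (j - i))"
    have hi: "?f k = f (k + (j - i))" if "i \<le> k" for k
      using that ij eq by (cases "k = i") auto
    have "?f (m - (j - i)) = f m"
    proof (cases "m = j")
      case True
      then have "m - (j - i) = i" using ij by linarith
      then show ?thesis using True eq by simp
    next
      case False
      then have "i \<le> m - (j - i)" "m - (j - i) + (j - i) = m" using ij by linarith+
      then show ?thesis using hi by metis
    qed
    moreover have "rot_walk P cv ce ?f (m - (j - i))"
      by (rule rot_walk_shortcut[OF f(1) ij _ hi]) simp_all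
    moreover have "?f 0 = g 0" using f(2) by simp
    ultimately have "Q (m - (j - i))"
      unfolding Q_def using f(3) by (intro exI[of _ ?f]) simp
    then show False using min[of "m - (j - i)"] ij by linarith
  qed
  then have inj: "inj_on f {..m}"
    by (metis atMost_iff inj_onI nat_neq_iff)
  have verts: "f i \<in> pverts P" if "i \<le> m" for i
    using f(1) that unfolding rot_walk_def by blast
  have arc: "(f i, f (Suc i)) \<in> parcs P" if "i < m" for i
    using f(1) that unfolding rot_walk_def by blast
  have rot: "cv (f (Suc i)) = (ce {f i, f (Suc i)} + 1) mod 3"
    "ce {f (Suc i), f (Suc (Suc i))} = (cv (f (Suc i)) + 1) mod 3" if "Suc i < m" for i
    using f(1) that unfolding rot_walk_def rot_in_def rot_out_def by auto
  \<comment> \<open>Here \<open>a\<close>, \<open>b\<close>, \<open>(b + 1) mod 3\<close> are the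
    colours of an edge, a vertex and the next edge; the last conjunct compares the vertex with its
    successor.\<close>
  have mod3: "a \<noteq> b \<and> b \<noteq> (b + 1) mod 3 \<and> a \<noteq> (b + 1) mod 3 \<and> b \<noteq> ((b + 1) mod 3 + 1) mod 3"
    if "a < 3" "b = (a + 1) mod 3" for a b :: nat
  proof -
    have "a = 0 \<or> a = 1 \<or> a = 2" using that(1) by linarith
    then show ?thesis using that(2) by auto
  qed
  have ve: "cv (f (Suc i)) \<noteq> ce {f i, f (Suc i)}" "cv (f (Suc i)) \<noteq> ce {f (Suc i), f (Suc (Suc i))}"
    and ee: "ce {f i, f (Suc i)} \<noteq> ce {f (Suc i), f (Suc (Suc i))}" if "Suc i < m" for i
    using mod3[OF ce rot(1)[OF that]] rot(2)[OF that] by metis+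
  have vv: "cv (f i) \<noteq> cv (f (Suc i))" if i: "0 < i" "Suc i < m" for i
  proof -
    obtain k where k: "i = Suc k" using i(1) by (cases i) auto
    then have "Suc k < m" using i(2) by simp
    then show ?thesis
      using mod3[OF ce rot(1)[of k]] rot(2)[of k] rot(1)[OF i(2)] unfolding k by metis
  qed
  have "total_proper_path P cv ce (map f [0..<Suc m])"
  proof (rule total_proper_path_map[OF verts inj arc vv ee])
    fix i assume i: "0 < i" "i < m"
    then obtain k where "i = Suc k" by (cases i) auto
    with ve[of k] i show "cv (f i) \<noteq> ce {f (i - 1), f i} \<and> cv (f i) \<noteq> ce {f i, f (Suc i)}"
      by simp
  qed
  moreover have "hd (map f [0..<Suc m]) = g 0" "last (map f [0..<Suc m]) = g n"
    by (simp_all only: hd_last_map_upt f)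
  ultimately show "\<exists>p. total_proper_path P cv ce p \<and> hd p = g 0 \<and> last p = g n"
    by blast
  let ?f = "\<lambda>i. f (m - i)"
  have "total_proper_path P cv ce (map ?f [0..<Suc m])"
  proof (rule total_proper_path_map)
    show "inj_on ?f {..m}"
    proof (rule inj_onI)
      fix i j assume ij: "i \<in> {..m}" "j \<in> {..m}" "?f i = ?f j"
      then have "m - i = m - j"
        using inj by (auto dest: inj_onD)
      then show "i = j" using ij by auto
    qed
    show "?f i \<in> pverts P" if "i \<le> m" for i
      by (rule verts) simp
    show "(?f i, ?f (Suc i)) \<in> parcs P" if i: "i < m" for i
    proof -
      have "m - i = Suc (m - Suc i)" "m - Suc i < m" using i by linarith+
      then show ?thesis using arcs_symmetric[OF arc] by metis
    qed
    show "cv (?f i) \<noteq> cv (?f (Suc i))" if i: "0 < i" "Suc i < m" for i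
    proof -
      have "m - i = Suc (m - Suc i)" "0 < m - Suc i" "Suc (m - Suc i) < m" using i by linarith+
      then show ?thesis using vv by metis
    qed
    show "ce {?f i, ?f (Suc i)} \<noteq> ce {?f (Suc i), ?f (Suc (Suc i))}" if i: "Suc i < m" for i
    proof -
      define k where "k = m - Suc (Suc i)"
      have "m - Suc (Suc i) = k" "m - Suc i = Suc k" "m - i = Suc (Suc k)" "Suc k < m"
        using i unfolding k_def by linarith+
      then show ?thesis using ee[of k] by (metis insert_commute)
    qed
    show "cv (?f i) \<noteq> ce {?f (i - 1), ?f i} \<and> cv (?f i) \<noteq> ce {?f i, ?f (Suc i)}"
      if i: "0 < i" "i < m" for i
    proof -
      define k where "k = m - Suc i"
      have "m - Suc i = k" "m - i = Suc k" "m - (i - 1) = Suc (Suc k)" "Suc k < m"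
        using i unfolding k_def by linarith+
      then show ?thesis using ve[of k] by (metis insert_commute)
    qed
  qed
  moreover have "hd (map ?f [0..<Suc m]) = g n" "last (map ?f [0..<Suc m]) = g 0"
    by (simp_all only: hd_last_map_upt f diff_self_eq_0 diff_zero)
  ultimately show "\<exists>p. total_proper_path P cv ce p \<and> hd p = g n \<and> last p = g 0"
    by blast
qed

section \<open>Rotating walks from reachability\<close>

text \<open>Such arcs fit the colours of both their ends, so they can be chained without further
  checks, and a closure describes the inner part of a walk.\<close>

definition rot_arcs :: "'a pair_pre_digraph \<Rightarrow> ('a \<Rightarrow> nat) \<Rightarrow> ('a set \<Rightarrow> nat) \<Rightarrow> ('a \<times> 'a) set" where
  "rot_arcs P cv ce = {(x, y) \<in> parcs P. rot_in cv ce x y \<and> rot_out cv ce x y}"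

text \<open>The first arc need only fit its head and the last one its tail, because end vertices are
  unconstrained.\<close>

lemma ex_rot_walk:
  assumes P: "pair_graph P" and uw: "(u, w) \<in> parcs P" "rot_in cv ce u w"
    and "(w, w') \<in> (rot_arcs P cv ce)\<^sup>*" and w'v: "(w', v) \<in> parcs P" "rot_out cv ce w' v"
  obtains g n where "rot_walk P cv ce g n" and "g 0 = u" and "g n = v"
proof -
  interpret pair_graph P by fact
  obtain m where "(w, w') \<in> rot_arcs P cv ce ^^ m"
    using assms(4) rtrancl_imp_relpow by metis
  then obtain f where f: "f 0 = w" "f m = w'" "\<And>i. i < m \<Longrightarrow> (f i, f (Suc i)) \<in> rot_arcs P cv ce"
    unfolding relpow_fun_conv by blast
  define g where "g i = (case i of 0 \<Rightarrow> u | Suc k \<Rightarrow> if k \<le> m then f k else v)" for i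
  have arc: "(g i, g (Suc i)) \<in> parcs P" if i: "i < Suc (Suc m)" for i
    using i uw w'v f unfolding g_def rot_arcs_def
    by (cases i) (auto simp: less_Suc_eq)
  have inn: "rot_in cv ce (g i) (g (Suc i))" if i: "i < Suc m" for i
    using i uw f unfolding g_def rot_arcs_def by (cases i) (auto simp: less_Suc_eq)
  have out: "rot_out cv ce (g (Suc i)) (g (Suc (Suc i)))" if i: "i < Suc m" for i
    using i w'v f unfolding g_def rot_arcs_def by (auto simp: less_Suc_eq)
  have "rot_walk P cv ce g (Suc (Suc m))"
    unfolding rot_walk_def
  proof (intro conjI allI impI)
    fix i assume "i \<le> Suc (Suc m)"
    then show "g i \<in> pverts P"
      using in_arcsD1[OF arc[of i]] in_arcsD2[OF arc[of "Suc m"]] by (cases "i = Suc (Suc m)") auto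
  qed (use arc inn out in auto)
  moreover have "g 0 = u" "g (Suc (Suc m)) = v"
    by (auto simp: g_def)
  ultimately show thesis using that by blast
qed

text \<open>Asking for both directions makes the relation symmetric by definition, which lets either
  vertex of a pair be the start.\<close>

definition tp_joined :: "'a pair_pre_digraph \<Rightarrow> ('a \<Rightarrow> nat) \<Rightarrow> ('a set \<Rightarrow> nat) \<Rightarrow> 'a \<Rightarrow> 'a \<Rightarrow> bool" where
  "tp_joined P cv ce u v \<longleftrightarrow>
     (\<exists>p. total_proper_path P cv ce p \<and> hd p = u \<and> last p = v) \<and>
     (\<exists>p. total_proper_path P cv ce p \<and> hd p = v \<and> last p = u)"

lemma tp_joined_commute: "tp_joined P cv ce u v \<longleftrightarrow> tp_joined P cv ce v u"
  unfolding tp_joined_def by blast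

lemma tp_joined_refl: "u \<in> pverts P \<Longrightarrow> tp_joined P cv ce u u"
  unfolding tp_joined_def total_proper_path_def vpath_def vwalk_def
  by (auto intro!: exI[of _ "[u]"])

lemma tp_joined_arc:
  assumes "pair_graph P" and "(u, v) \<in> parcs P"
  shows "tp_joined P cv ce u v"
proof -
  interpret pair_graph P by fact
  have "u \<noteq> v" using pair_no_loops[OF assms(2)] by simp
  then have "total_proper_path P cv ce [u, v]" "total_proper_path P cv ce [v, u]"
    using assms(2) arcs_symmetric[OF assms(2)] in_arcsD1[OF assms(2)] in_arcsD2[OF assms(2)]
    by (auto simp: total_proper_path_def vpath_def vwalk_def)
  then show ?thesis
    unfolding tp_joined_def by fastforce
qed

lemma tp_joined_rot:
  assumes P: "pair_graph P" and ce: "\<And>e. ce e < 3"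
    and "(u, w) \<in> parcs P" "rot_in cv ce u w"
    and "(w, w') \<in> (rot_arcs P cv ce)\<^sup>*" and "(w', v) \<in> parcs P" "rot_out cv ce w' v"
  shows "tp_joined P cv ce u v"
proof -
  from ex_rot_walk[OF P assms(3-7)]
  obtain g n where g: "rot_walk P cv ce g n" "g 0 = u" "g n = v" .
  show ?thesis
    using rot_walk_imp_total_proper_paths[OF P ce g(1)] unfolding tp_joined_def g(2,3) by blast
qed

section \<open>A rotating colouring of the lexicographic product\<close>

locale layered_lex_product =
  G: pair_graph G + H: pair_graph H
  for G :: "'a pair_pre_digraph" and H :: "'b pair_pre_digraph" +
  fixes r l :: 'a and d :: "'a \<Rightarrow> nat" and h1 h2 :: 'b
  assumes h: "h1 \<in> pverts H" "h2 \<in> pverts H" "h1 \<noteq> h2"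
    and rl: "(r, l) \<in> parcs G" "r \<noteq> l" "d r = 0" "d l = 1"
    and ex_parent: "v \<in> pverts G \<Longrightarrow> v \<noteq> r \<Longrightarrow> \<exists>p. p \<noteq> l \<and> (p, v) \<in> parcs G \<and> d v = Suc (d p)"
begin

abbreviation P where "P \<equiv> lexicographic_product G H"

text \<open>
  Walks climb towards the root along the copy \<open>h1\<close> and descend along the copy \<open>h2\<close>; in both
  cases the colours, as functions of the depth, rotate in the same direction. The vertex \<open>(l, h1)\<close>
  is the turning point between the two copies of the root. It is available because no vertex has
  parent \<open>l\<close>.
\<close>

definition cv :: "'a \<times> 'b \<Rightarrow> nat" where
  "cv x = (case x of (t, k) \<Rightarrow>
     if t = l then (if k = h1 then 2 else 1)
     else if k = h1 then d t mod 3 else (1 + 2 * d t) mod 3)"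

text \<open>The second case serves to join two copies of the root, both different from \<open>(r, h1)\<close>.\<close>

definition ce :: "('a \<times> 'b) set \<Rightarrow> nat" where
  "ce e =
    (if (l, h1) \<in> e then (if (r, h1) \<in> e then 1 else 0)
     else if (l, h2) \<in> e \<and> (\<exists>k. k \<noteq> h1 \<and> k \<noteq> h2 \<and> (r, k) \<in> e) then 0
     else let m = Max ((d \<circ> fst) ` e) in
       if \<exists>p. d p < m \<and> (p, h1) \<in> e then (m + 1) mod 3 else 2 * m mod 3)"

section \<open>Edge colours between layers and at the turn\<close>

lemma ce_less: "ce e < 3"
  unfolding ce_def Let_def by auto

text \<open>An arc and its end vertex advance the rotation by two, that is by -1 modulo 3. So
  colours must vary like \<open>d\<close> while climbing and like \<open>- d\<close>, written
  \<open>2 * d\<close>, while descending; the copy containing the upper end decides which.\<close>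

lemma ce_layer:
  assumes "d c = Suc (d p)" and "(c, k) \<noteq> (l, h1)" and "p \<noteq> l"
    and "\<not> (c = l \<and> k = h2 \<and> p = r \<and> k' \<noteq> h1 \<and> k' \<noteq> h2)"
  shows "ce {(c, k), (p, k')} = (if k' = h1 then (d c + 1) mod 3 else 2 * d c mod 3)"
proof -
  have "c \<noteq> r"
    using assms(1) rl by auto
  moreover have "Max ((d \<circ> fst) ` {(c, k), (p, k')}) = d c"
    using assms(1) by simp
  moreover have "(\<exists>q. d q < d c \<and> (q, h1) \<in> {(c, k), (p, k')}) \<longleftrightarrow> k' = h1"
    using assms(1) by auto
  ultimately show ?thesis
    using assms(2-4) unfolding ce_def Let_def by auto
qed

text \<open>The first three values deviate from the layered pattern, which would give 2 each time;
  the fourth follows it.\<close>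

lemma ce_turn:
  "ce {(l, h1), (r, h1)} = 1"
  "k \<noteq> h1 \<Longrightarrow> ce {(l, h1), (r, k)} = 0"
  "k \<noteq> h1 \<Longrightarrow> k \<noteq> h2 \<Longrightarrow> ce {(l, h2), (r, k)} = 0"
  "ce {(l, h2), (r, h1)} = 2"
  using h rl ce_layer[of l r h2 h1] by (auto simp: ce_def)

lemma arc_lex:
  assumes "(s, t) \<in> parcs G" and "k \<in> pverts H" and "k' \<in> pverts H"
  shows "((s, k), (t, k')) \<in> parcs P" and "((t, k), (s, k')) \<in> parcs P"
  using assms G.arcs_symmetric[OF assms(1)] G.in_arcsD1[OF assms(1)] G.in_arcsD2[OF assms(1)]
  by (auto simp: lexicographic_product_def)

lemma up_in:
  assumes "d c = Suc (d p)" and "p \<noteq> l" and "(c, k) \<noteq> (l, h1)"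
  shows "rot_in cv ce (c, k) (p, h1)"
proof -
  have "ce {(c, k), (p, h1)} = (d c + 1) mod 3"
    using ce_layer[of c p k h1] assms by simp
  then show ?thesis
    using assms(1,2) unfolding rot_in_def cv_def by simp presburger
qed

lemma up_out:
  assumes "d c = Suc (d p)" and "p \<noteq> l" and "c \<noteq> l"
  shows "rot_out cv ce (c, h1) (p, h1)"
proof -
  have "ce {(c, h1), (p, h1)} = (d c + 1) mod 3"
    using ce_layer[of c p h1 h1] assms by simp
  then show ?thesis
    using assms(3) unfolding rot_out_def cv_def by simp presburger
qed

lemma down_in:
  assumes "d c = Suc (d p)" and "p \<noteq> l" and "c \<noteq> l" and "k \<noteq> h1"
  shows "rot_in cv ce (p, k) (c, h2)"
proof -
  have "ce {(p, k), (c, h2)} = 2 * d c mod 3"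
    using ce_layer[of c p h2 k] assms by (simp add: insert_commute)
  then show ?thesis
    using assms(3) h unfolding rot_in_def cv_def by simp presburger
qed

lemma down_out:
  assumes "d c = Suc (d p)" and "p \<noteq> l" and "(c, k) \<noteq> (l, h1)"
  shows "rot_out cv ce (p, h2) (c, k)"
proof -
  have "ce {(p, h2), (c, k)} = 2 * d c mod 3"
    using ce_layer[of c p k h2] assms h by (simp add: insert_commute)
  then show ?thesis
    using assms(1,2) h unfolding rot_out_def cv_def by simp presburger
qed

lemma up_arc:
  assumes "(p, c) \<in> parcs G" and "d c = Suc (d p)" and "p \<noteq> l" and "c \<noteq> l"
  shows "((c, h1), (p, h1)) \<in> rot_arcs P cv ce"
proof -
  have "rot_in cv ce (c, h1) (p, h1)"
    using assms(4) by (intro up_in assms) simp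
  then show ?thesis
    using arc_lex(2)[OF assms(1) h(1) h(1)] up_out[OF assms(2-4)] by (simp add: rot_arcs_def)
qed

lemma down_arc:
  assumes "(p, c) \<in> parcs G" and "d c = Suc (d p)" and "p \<noteq> l" and "c \<noteq> l"
  shows "((p, h2), (c, h2)) \<in> rot_arcs P cv ce"
proof -
  have "rot_out cv ce (p, h2) (c, h2)"
    using assms(4) by (intro down_out assms) simp
  then show ?thesis
    using arc_lex(1)[OF assms(1) h(2) h(2)] down_in[OF assms(2-4) h(3)[symmetric]]
    by (simp add: rot_arcs_def)
qed

section \<open>Climbing, descending and turning\<close>

lemma up_chain:
  assumes "p \<in> pverts G" and "p \<noteq> l"
  shows "((p, h1), (r, h1)) \<in> (rot_arcs P cv ce)\<^sup>*"
  using assms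
proof (induction "d p" arbitrary: p rule: less_induct)
  case less
  show ?case
  proof (cases "p = r")
    case False
    then obtain q where q: "q \<noteq> l" "(q, p) \<in> parcs G" "d p = Suc (d q)"
      using ex_parent less.prems by blast
    have "((q, h1), (r, h1)) \<in> (rot_arcs P cv ce)\<^sup>*"
      using less.hyps[OF _ G.in_arcsD1[OF q(2)] q(1)] q(3) by simp
    then show ?thesis
      using up_arc[OF q(2,3,1) less.prems(2)] by (rule converse_rtrancl_into_rtrancl[rotated])
  qed simp
qed

lemma down_chain:
  assumes "p \<in> pverts G" and "p \<noteq> l" and "p \<noteq> r" and k: "k \<in> pverts H" "k \<noteq> h1"
  shows "\<exists>w. ((r, k), w) \<in> parcs P \<and> rot_in cv ce (r, k) w \<and> (w, (p, h2)) \<in> (rot_arcs P cv ce)\<^sup>*"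
  using assms(1-3)
proof (induction "d p" arbitrary: p rule: less_induct)
  case less
  obtain q where q: "q \<noteq> l" "(q, p) \<in> parcs G" "d p = Suc (d q)"
    using ex_parent less.prems by blast
  show ?case
  proof (cases "q = r")
    case True
    then show ?thesis
      using arc_lex(1)[OF q(2) k(1) h(2)] down_in[OF q(3,1) less.prems(2) k(2)] by blast
  next
    case False
    then obtain w where w: "((r, k), w) \<in> parcs P" "rot_in cv ce (r, k) w"
      "(w, (q, h2)) \<in> (rot_arcs P cv ce)\<^sup>*"
      using less.hyps[OF _ G.in_arcsD1[OF q(2)] q(1)] q(3) by auto
    from w(3) have "(w, (p, h2)) \<in> (rot_arcs P cv ce)\<^sup>*"
      using down_arc[OF q(2,3,1) less.prems(2)] by (rule rtrancl_into_rtrancl)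
    with w(1,2) show ?thesis by blast
  qed
qed

lemma down_chain_root:
  assumes "p \<in> pverts G" and "p \<noteq> l"
  shows "((r, h2), (p, h2)) \<in> (rot_arcs P cv ce)\<^sup>*"
  using assms
proof (induction "d p" arbitrary: p rule: less_induct)
  case less
  show ?case
  proof (cases "p = r")
    case False
    then obtain q where q: "q \<noteq> l" "(q, p) \<in> parcs G" "d p = Suc (d q)"
      using ex_parent less.prems by blast
    have "((r, h2), (q, h2)) \<in> (rot_arcs P cv ce)\<^sup>*"
      using less.hyps[OF _ G.in_arcsD1[OF q(2)] q(1)] q(3) by simp
    then show ?thesis
      using down_arc[OF q(2,3,1) less.prems(2)] by (rule rtrancl_into_rtrancl)
  qed simp
qed

text \<open>Along \<open>(r, h1)\<close>, \<open>(l, h1)\<close>, \<open>(r, h2)\<close> the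
  vertices and edges have the colours 0, 1, 2, 0, 1 in order.\<close>

lemma turn_in:
  "rot_in cv ce (r, h1) (l, h1)"
  "rot_in cv ce (l, h1) (r, h2)"
  using rl h ce_turn by (simp_all add: rot_in_def cv_def insert_commute)

lemma turn_out:
  "rot_out cv ce (r, h1) (l, h1)"
  "k \<noteq> h1 \<Longrightarrow> rot_out cv ce (l, h1) (r, k)"
  using rl h ce_turn by (simp_all add: rot_out_def cv_def insert_commute)

lemma turn_arcs:
  "((r, h1), (l, h1)) \<in> rot_arcs P cv ce"
  "((l, h1), (r, h2)) \<in> rot_arcs P cv ce"
  using arc_lex[OF rl(1)] h turn_in turn_out by (auto simp: rot_arcs_def)

section \<open>Joining all pairs of vertices\<close>

text \<open>The turn is entered at its beginning from \<open>(r, h1)\<close>, in its middle from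
  \<open>(l, h1)\<close>, and otherwise after a climb in the copy \<open>h1\<close>.\<close>

lemma start:
  assumes u: "(t, k) \<in> pverts P" and "t = r \<Longrightarrow> k = h1"
  shows "\<exists>w. ((t, k), w) \<in> parcs P \<and> rot_in cv ce (t, k) w \<and> (w, (r, h2)) \<in> (rot_arcs P cv ce)\<^sup>*"
proof -
  have tk: "t \<in> pverts G" "k \<in> pverts H"
    using u by (auto simp: lexicographic_product_def)
  consider "t = r" | "(t, k) = (l, h1)" | "t \<noteq> r" "(t, k) \<noteq> (l, h1)"
    by blast
  then show ?thesis
  proof cases
    case 1
    then show ?thesis
      using assms(2) turn_in(1) turn_arcs arc_lex[OF rl(1)] h by blast
  next
    case 2
    then show ?thesis
      using turn_in(2) arc_lex[OF rl(1)] h by blast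
  next
    case 3
    then obtain p where p: "p \<noteq> l" "(p, t) \<in> parcs G" "d t = Suc (d p)"
      using ex_parent tk by blast
    then have "((p, h1), (r, h1)) \<in> (rot_arcs P cv ce)\<^sup>*"
      using up_chain G.in_arcsD1 by blast
    then have "((p, h1), (r, h2)) \<in> (rot_arcs P cv ce)\<^sup>*"
      using turn_arcs by (blast intro: rtrancl_into_rtrancl)
    then show ?thesis
      using up_in[OF p(3,1) 3(2)] arc_lex[OF p(2)] tk h by blast
  qed
qed

text \<open>Climb, turn, descend in the copy \<open>h2\<close> to a parent of \<open>s\<close>, then
  step to the copy \<open>k'\<close>. The target \<open>(l, h1)\<close> is excluded because its edge
  from \<open>(r, h2)\<close> has the turning colour instead of the descending one.\<close>

lemma joined_via_turn:
  assumes u: "(t, k) \<in> pverts P" "t = r \<Longrightarrow> k = h1"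
    and v: "(s, k') \<in> pverts P" "s \<noteq> r" "(s, k') \<noteq> (l, h1)"
  shows "tp_joined P cv ce (t, k) (s, k')"
proof -
  have sk: "s \<in> pverts G" "k' \<in> pverts H"
    using v by (auto simp: lexicographic_product_def)
  then obtain p where p: "p \<noteq> l" "(p, s) \<in> parcs G" "d s = Suc (d p)"
    using ex_parent v(2) by blast
  from start[OF u] obtain w where w: "((t, k), w) \<in> parcs P" "rot_in cv ce (t, k) w"
    "(w, (r, h2)) \<in> (rot_arcs P cv ce)\<^sup>*"
    by blast
  have chain: "(w, (p, h2)) \<in> (rot_arcs P cv ce)\<^sup>*"
    using w(3) down_chain_root[OF G.in_arcsD1[OF p(2)] p(1)] by (rule rtrancl_trans)
  have "((p, h2), (s, k')) \<in> parcs P"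
    using arc_lex[OF p(2)] sk h by blast
  then show ?thesis
    using tp_joined_rot[OF pair_graph_lexicographic_product[OF G.pair_graph H.pair_graph] ce_less w(1,2) chain]
      down_out[OF p(3,1) v(3)] by blast
qed

lemma joined_root_other:
  assumes "k \<in> pverts H" and "s \<in> pverts G" "k' \<in> pverts H" "s \<noteq> r"
  shows "tp_joined P cv ce (r, k) (s, k')"
proof -
  note pgP = pair_graph_lexicographic_product[OF G.pair_graph H.pair_graph]
  obtain p where p: "p \<noteq> l" "(p, s) \<in> parcs G" "d s = Suc (d p)"
    using ex_parent assms by blast
  have pG: "p \<in> pverts G" "r \<in> pverts G"
    using G.in_arcsD1[OF p(2)] G.in_arcsD1[OF rl(1)] .
  show ?thesis
  proof (cases "p = r")
    case True
    then show ?thesis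
      using tp_joined_arc[OF pgP arc_lex(1)[OF p(2)]] assms by blast
  next
    case False
    \<comment> \<open>The depth of \<open>s\<close> is thus at least 2, whereas
      \<open>d l = 1\<close>.\<close>
    then have "d p \<noteq> 0"
      using ex_parent[OF pG(1)] by auto
    then have s: "(s, k') \<noteq> (l, h1)"
      using p(3) rl by auto
    show ?thesis
    proof (cases "k = h1")
      case True
      then show ?thesis
        using joined_via_turn[of r k s k'] s assms pG by (simp add: lexicographic_product_def)
    next
      case k: False
      obtain w where w: "((r, k), w) \<in> parcs P" "rot_in cv ce (r, k) w"
        "(w, (p, h2)) \<in> (rot_arcs P cv ce)\<^sup>*"
        using down_chain[OF pG(1) p(1) False assms(1) k] by blast
      show ?thesis
        using tp_joined_rot[OF pgP ce_less w arc_lex(1)[OF p(2) h(2) assms(3)]]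
          down_out[OF p(3,1) s] by blast
    qed
  qed
qed

text \<open>For \<open>k' \<noteq> h1\<close> the walk is \<open>(r, k')\<close>,
  \<open>(l, h2)\<close>, \<open>(r, h1)\<close>, \<open>(l, h1)\<close>, \<open>(r, k)\<close>; its
  edges and inner vertices have the colours 0, 1, 2, 0, 1, 2, 0. For \<open>k' = h1\<close> its last
  two arcs suffice.\<close>

lemma joined_roots:
  assumes k: "k \<in> pverts H" and k': "k' \<in> pverts H" and "k \<noteq> h1" "k' \<noteq> h2" "k \<noteq> k'"
  shows "tp_joined P cv ce (r, k') (r, k)"
proof -
  note pgP = pair_graph_lexicographic_product[OF G.pair_graph H.pair_graph]
  have last: "((l, h1), (r, k)) \<in> parcs P" "rot_out cv ce (l, h1) (r, k)"
    using arc_lex[OF rl(1)] h k turn_out(2) assms(3) by auto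
  show ?thesis
  proof (cases "k' = h1")
    case True
    then show ?thesis
      using tp_joined_rot[OF pgP ce_less _ turn_in(1) rtrancl_refl last] arc_lex[OF rl(1)] h by auto
  next
    case False
    have "rot_in cv ce (r, k') (l, h2)"
      using False assms(4) ce_turn(3) h by (simp add: rot_in_def cv_def insert_commute)
    moreover have "((r, k'), (l, h2)) \<in> parcs P"
      using arc_lex[OF rl(1)] h k' by blast
    moreover have "((l, h2), (r, h1)) \<in> rot_arcs P cv ce"
      using arc_lex[OF rl(1)] h rl ce_turn(4) by (auto simp: rot_arcs_def rot_in_def rot_out_def cv_def)
    then have "((l, h2), (l, h1)) \<in> (rot_arcs P cv ce)\<^sup>*"
      using turn_arcs(1) by (rule converse_rtrancl_into_rtrancl[OF _ r_into_rtrancl])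
    ultimately show ?thesis
      using tp_joined_rot[OF pgP ce_less _ _ _ last] by blast
  qed
qed

lemma total_proper_connected_lex: "total_proper_connected P cv ce"
proof -
  have "tp_joined P cv ce (t, k) (s, k')"
    if t: "t \<in> pverts G" and k: "k \<in> pverts H" and s: "s \<in> pverts G" and k': "k' \<in> pverts H"
    for t k s k'
  proof -
    have P: "(t, k) \<in> pverts P" "(s, k') \<in> pverts P"
      using that by (auto simp: lexicographic_product_def)
    \<comment> \<open>Of two distinct vertices outside the root copies at most one is
      \<open>(l, h1)\<close>; the other can be the target.\<close>
    consider "(t, k) = (s, k')" | "t = r" "s = r" "k \<noteq> k'" | "t = r" "s \<noteq> r" | "t \<noteq> r" "s = r"
      | "t \<noteq> r" "s \<noteq> r" "(s, k') \<noteq> (l, h1)" | "t \<noteq> r" "s \<noteq> r" "(t, k) \<noteq> (l, h1)"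
      by blast
    then show ?thesis
    proof cases
      case 1
      then show ?thesis using tp_joined_refl[OF P(1)] by simp
    next
      case 2
      \<comment> \<open>As \<open>k \<noteq> k'\<close> and \<open>h1 \<noteq> h2\<close>, one of
        the two orders meets the side conditions of \<open>joined_roots\<close>.\<close>
      then consider "k \<noteq> h1" "k' \<noteq> h2" | "k' \<noteq> h1" "k \<noteq> h2"
        using h by blast
      then show ?thesis
      proof cases
        case 1
        then show ?thesis
          using joined_roots[OF k k'] 2 tp_joined_commute[of P cv ce "(r, k)"] by simp
      next
        case 2
        then show ?thesis
          using joined_roots[OF k' k] \<open>t = r\<close> \<open>s = r\<close> \<open>k \<noteq> k'\<close> by simp
      qed
    next
      case 3
      then show ?thesis using joined_root_other[OF k s k'] by simp
    next
      case 4
      then show ?thesis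
        using joined_root_other[OF k' t k] tp_joined_commute[of P cv ce "(t, k)"] by simp
    next
      case 5
      then show ?thesis using joined_via_turn[OF P(1) _ P(2)] by blast
    next
      case 6
      then show ?thesis
        using joined_via_turn[OF P(2) _ P(1)] tp_joined_commute[of P cv ce "(t, k)"] by blast
    qed
  qed
  then show ?thesis
    unfolding total_proper_connected_def tp_joined_def by (auto simp: lexicographic_product_def)
qed

lemma num_colors_le: "num_colors P cv ce \<le> 3"
proof -
  have "cv x < 3" for x
    unfolding cv_def by (auto split: prod.split)
  then have "cv ` pverts P \<union> ce ` uedges P \<subseteq> {..<3}"
    using ce_less by auto
  then show ?thesis
    unfolding num_colors_def using card_mono[of "{..<3}"] by fastforce
qed

end

section \<open>The two bounds combined for the product\<close>

theorem theorem5p1: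
  fixes G :: "'a pair_pre_digraph" and H :: "'b pair_pre_digraph"
  assumes "pair_graph G" and "pair_graph H"
    and "2 \<le> card (pverts G)" and "2 \<le> card (pverts H)"
    and "Digraph_Component.connected (with_proj G)"
    and "\<not> complete_graph (lexicographic_product G H)"
  shows "tpc (lexicographic_product G H) = 3"
proof -
  interpret G: pair_graph G by fact
  interpret H: pair_graph H by fact
  let ?P = "lexicographic_product G H"
  obtain h1 h2 where h: "h1 \<in> pverts H" "h2 \<in> pverts H" "h1 \<noteq> h2"
    using assms(4) card_le_Suc0_iff_eq[OF H.pair_finite_verts] by fastforce
  \<comment> \<open>Since arcs are symmetric, connectedness gives directed reachability between any
    two vertices.\<close>
  have conn: "(u, v) \<in> (parcs G)\<^sup>*" if "u \<in> pverts G" "v \<in> pverts G" for u v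
    using G.symmetric_connected_imp_strongly_connected[OF G.sym_arcs assms(5)] that
      G.reachable_conv[of u v] by (auto simp: strongly_connected_def)
  have "parcs G \<subseteq> pverts G \<times> pverts G"
    using G.in_arcsD1 G.in_arcsD2 by auto
  moreover have "sym (parcs G)"
    using G.arcs_symmetric by (auto simp: sym_def)
  ultimately obtain r l and d :: "'a \<Rightarrow> nat" where
    "(r, l) \<in> parcs G" "r \<noteq> l" "d r = 0" "d l = 1"
    "\<And>v. v \<in> pverts G \<Longrightarrow> v \<noteq> r \<Longrightarrow> \<exists>p. p \<noteq> l \<and> (p, v) \<in> parcs G \<and> d v = Suc (d p)"
    using ex_layering[OF G.pair_finite_verts assms(3) _ _ conn] by metis
  then interpret layered_lex_product G H r l d h1 h2
    using h by unfold_locales blast+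
  have lower: "3 \<le> num_colors ?P cv' ce'" if "total_proper_connected ?P cv' ce'" for cv' ce'
    using three_le_num_colors[OF pair_graph_lexicographic_product[OF assms(1,2)] assms(6) that] .
  have "num_colors ?P cv ce = 3"
    using lower[OF total_proper_connected_lex] num_colors_le by simp
  then show ?thesis
    unfolding tpc_def using total_proper_connected_lex lower
    by (intro Least_equality) blast+
qed

end
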